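(* The Hamiltonian functions $H_1,H_3,H_{12}$ (defined in the context) are unique in the following sense: if $H_1'\in\mathbb{C}[t,c,y_1,z_1]$, $H_3'\in\mathbb{C}[t,c,y_3,z_3]$, $H_{12}'\in\mathbb{C}[t,c,y_{12},z_{12}]$ are polynomials such that the three 2-forms (relative to $\operatorname{Spec}\mathbb{C}[c]$) $$dy_1\wedge dz_1+dH_1'\wedge dt,\qquad dy_3\wedge dz_3+dH_3'\wedge dt,\qquad dy_{12}\wedge dz_{12}+dH_{12}'\wedge dt$$ on $\mathcal{W}_1,\mathcal{W}_3,\mathcal{W}_{12}$ respectively glue together to a 2-form on $\mathcal{W}_1\cup\mathcal{W}_3\cup\mathcal{W}_{12}$ over $\operatorname{Spec}\mathbb{C}[c]$, then $H_i-H_i'$ does not depend on $y_i,z_i$ for $i=1,3,12$.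
   Context: The ground field is $\mathbb{C}$. Let $\mathcal{W}_i=\operatorname{Spec}\mathbb{C}[y_i,z_i,t,c]$ for $i=1,3,12$. They are glued to a variety $\mathcal{W}_1\cup\mathcal{W}_3\cup\mathcal{W}_{12}$ over $\operatorname{Spec}\mathbb{C}[t,c]$ (so points are identified only if they have the same $t$ and the same $c$) by the rules: $\mathcal{W}_1,\mathcal{W}_3$: $y_1y_3=1$ and $z_1=y_3(c-y_3z_3)$; $\mathcal{W}_1,\mathcal{W}_{12}$: $y_1y_{12}=1$ and $z_1+2y_1^2+t=y_{12}(-(c+1)-y_{12}z_{12})$; $\mathcal{W}_3,\mathcal{W}_{12}$: $y_3=y_{12}\ne0$ and $z_3=z_{12}+\frac{2c+1}{y_{12}}+\frac{t}{y_{12}^2}+\frac{2}{y_{12}^4}$. (This variety is the family, over the $(t,c)$-plane, of Okamoto's spaces of initial conditions of the second Painlevé equation.) All differentials and wedge products are taken relative to $\mathbb{C}[c]$: $dc=0$ but $dt\neq0$. The Hamiltonians are $H_1=y_1^2z_1+\frac12z_1^2+\frac t2z_1-cy_1$, $H_3(t,c,y_3,z_3)=H_1\bigl(t,c,\tfrac1{y_3},y_3(c-y_3z_3)\bigr)$ and $H_{12}(t,c,y_{12},z_{12})=H_3\bigl(t,c,y_{12},z_{12}+\frac{2c+1}{y_{12}}+\frac{t}{y_{12}^2}+\frac{2}{y_{12}^4}\bigr)-\frac1{y_{12}}$; these are polynomials in their variables, and the 2-forms $dy_i\wedge dz_i+dH_i\wedge dt$ ($i=1,3,12$) glue together. *)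

theory Defs
  imports Complex_Main "HOL-Library.Poly_Mapping" "HOL-Library.Product_Plus"
begin

section \<open>Coordinate rings\<close>

text \<open>
  Polynomial rings are monoid algebras: an exponent vector \<open>(i, j, k, l)\<close> stands for
  the monomial \<open>y\<^sup>i z\<^sup>j t\<^sup>k c\<^sup>l\<close>.  With natural exponents this gives
  the coordinate ring \<open>\<complex>[y, z, t, c]\<close> of a chart; allowing integer exponents of \<open>y\<close>
  gives the coordinate ring \<open>\<complex>[y, 1/y, z, t, c]\<close> of its open subset \<open>y \<noteq> 0\<close>.
\<close>

type_synonym 'e poly4 = "('e \<times> nat \<times> nat \<times> nat) \<Rightarrow>\<^sub>0 complex"
type_synonym chart_ring = "nat poly4"
type_synonym overlap_ring = "int poly4"

definition cst :: "complex \<Rightarrow> ('e::zero) poly4"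
  where "cst a = Poly_Mapping.single (0, 0, 0, 0) a"
definition vy :: "('e::zero_neq_one) poly4"
  where "vy = Poly_Mapping.single (1, 0, 0, 0) 1"
definition vz :: "('e::zero) poly4"
  where "vz = Poly_Mapping.single (0, 1, 0, 0) 1"
definition vt :: "('e::zero) poly4"
  where "vt = Poly_Mapping.single (0, 0, 1, 0) 1"
definition vc :: "('e::zero) poly4"
  where "vc = Poly_Mapping.single (0, 0, 0, 1) 1"
definition inv_vy :: overlap_ring
  where "inv_vy = Poly_Mapping.single (-1, 0, 0, 0) 1"


section \<open>Differential forms relative to \<open>\<complex>[c]\<close>\<close>

text \<open>
  A relative 1-form \<open>(a, b, e)\<close> stands for \<open>a dy + b dz + e dt\<close>, and a relative 2-form
  \<open>(p, q, r)\<close> for \<open>p dy\<and>dz + q dy\<and>dt + r dz\<and>dt\<close>: over both rings above, the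
  Kaehler differentials relative to \<open>\<complex>[c]\<close> are free on \<open>dy, dz, dt\<close>.
  Forms are added componentwise.
\<close>

type_synonym 'r form1 = "'r \<times> 'r \<times> 'r"
type_synonym 'r form2 = "'r \<times> 'r \<times> 'r"

definition wedge :: "('r::comm_ring_1) form1 \<Rightarrow> 'r form1 \<Rightarrow> 'r form2" (infixr "\<and>\<^sub>f" 75)
  where "wedge = (\<lambda>(a, b, e) (a', b', e'). (a * b' - b * a', a * e' - e * a', b * e' - e * b'))"

definition scale_form :: "('r::comm_ring_1) \<Rightarrow> 'r form2 \<Rightarrow> 'r form2" (infixr "*\<^sub>f" 75)
  where "scale_form s = (\<lambda>(p, q, r). (s * p, s * q, s * r))"

text \<open>
  \<open>pderiv_along w s\<close> sends each monomial with exponent vector \<open>m\<close> to \<open>w m\<close> times the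
  monomial with exponent vector \<open>m - s\<close>.  When a natural exponent is \<open>0\<close>, the
  truncated subtraction is harmless because the factor \<open>w m\<close> vanishes.
\<close>

definition pderiv_along ::
    "('e::minus \<times> nat \<times> nat \<times> nat \<Rightarrow> complex) \<Rightarrow> 'e \<times> nat \<times> nat \<times> nat
      \<Rightarrow> 'e poly4 \<Rightarrow> 'e poly4"
  where "pderiv_along w s F =
    (\<Sum>m\<in>Poly_Mapping.keys F. Poly_Mapping.single (m - s) (w m * Poly_Mapping.lookup F m))"

definition differential ::
    "('e::{minus, zero_neq_one} \<Rightarrow> complex) \<Rightarrow> 'e poly4 \<Rightarrow> 'e poly4 form1"
  where "differential cast F =
    (pderiv_along (\<lambda>(i, j, k, l). cast i) (1, 0, 0, 0) F,
     pderiv_along (\<lambda>(i, j, k, l). of_nat j) (0, 1, 0, 0) F,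
     pderiv_along (\<lambda>(i, j, k, l). of_nat k) (0, 0, 1, 0) F)"

abbreviation d_chart :: "chart_ring \<Rightarrow> chart_ring form1"
  where "d_chart \<equiv> differential of_nat"
abbreviation d_overlap :: "overlap_ring \<Rightarrow> overlap_ring form1"
  where "d_overlap \<equiv> differential of_int"

definition hamiltonian_form :: "chart_ring \<Rightarrow> chart_ring form2"
  where "hamiltonian_form H = (d_chart vy \<and>\<^sub>f d_chart vz) + (d_chart H \<and>\<^sub>f d_chart vt)"


section \<open>Gluing\<close>

text \<open>
  A morphism over \<open>Spec \<complex>[t, c]\<close> from an overlap to a chart is a pair \<open>(a, b)\<close> of
  elements of the overlap ring, the images of the chart coordinates \<open>y\<close> and \<open>z\<close>.
\<close>

type_synonym transition = "overlap_ring \<times> overlap_ring"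

definition pull_fun :: "transition \<Rightarrow> chart_ring \<Rightarrow> overlap_ring"
  where "pull_fun = (\<lambda>(a, b) F. \<Sum>m\<in>Poly_Mapping.keys F. case m of (i, j, k, l) \<Rightarrow>
    cst (Poly_Mapping.lookup F m) * a ^ i * b ^ j * vt ^ k * vc ^ l)"

definition pull_form :: "transition \<Rightarrow> chart_ring form2 \<Rightarrow> overlap_ring form2"
  where "pull_form = (\<lambda>(a, b) (p, q, r).
    (pull_fun (a, b) p *\<^sub>f (d_overlap a \<and>\<^sub>f d_overlap b)) +
    (pull_fun (a, b) q *\<^sub>f (d_overlap a \<and>\<^sub>f d_overlap vt)) +
    (pull_fun (a, b) r *\<^sub>f (d_overlap b \<and>\<^sub>f d_overlap vt)))"

definition incl :: transition
  where "incl = (vy, vz)"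

text \<open>
  Each overlap is the locus \<open>y \<noteq> 0\<close> in either of its charts, and is described here by the
  coordinates of the chart with the larger index: \<open>trans_3_1\<close> gives \<open>y\<^sub>1, z\<^sub>1\<close> in terms of
  \<open>y\<^sub>3, z\<^sub>3\<close>, and so on.
\<close>

definition trans_3_1 :: transition
  where "trans_3_1 = (inv_vy, vy * (vc - vy * vz))"

definition trans_12_1 :: transition
  where "trans_12_1 = (inv_vy, vy * (- (vc + 1) - vy * vz) - 2 * inv_vy ^ 2 - vt)"

definition trans_12_3 :: transition
  where "trans_12_3 =
    (vy, vz + (2 * vc + 1) * inv_vy + vt * inv_vy ^ 2 + 2 * inv_vy ^ 4)"

definition glue_together ::
    "chart_ring form2 \<Rightarrow> chart_ring form2 \<Rightarrow> chart_ring form2 \<Rightarrow> bool"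
  where "glue_together \<omega>1 \<omega>3 \<omega>12 \<longleftrightarrow>
    pull_form trans_3_1 \<omega>1 = pull_form incl \<omega>3 \<and>
    pull_form trans_12_1 \<omega>1 = pull_form incl \<omega>12 \<and>
    pull_form trans_12_3 \<omega>3 = pull_form incl \<omega>12"


section \<open>The Hamiltonians\<close>

text \<open>
  \<open>H3\<close> and \<open>H12\<close> are the polynomials that result from the substitutions in the lemmas
  \<open>H3_substitution\<close> and \<open>H12_substitution\<close> below; by \<open>pull_fun_incl_eq_iff\<close> those
  equations determine them.
\<close>

definition H1 :: chart_ring
  where "H1 = vy ^ 2 * vz + cst (1 / 2) * vz ^ 2 + cst (1 / 2) * vt * vz - vc * vy"

definition H3 :: chart_ring
  where "H3 = - vz + cst (1 / 2) * (vy * (vc - vy * vz)) ^ 2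
    + cst (1 / 2) * vt * (vy * (vc - vy * vz))"

definition H12 :: chart_ring
  where "H12 = vz + cst (1 / 2) * (vy * (vc + 1 + vy * vz)) ^ 2
    + cst (1 / 2) * vt * (vy * (vc + 1 + vy * vz))"

definition independent_of_yz :: "chart_ring \<Rightarrow> bool"
  where "independent_of_yz F \<longleftrightarrow> (\<forall>(i, j, k, l)\<in>Poly_Mapping.keys F. i = 0 \<and> j = 0)"


section \<open>Functions, differentials and the Hamiltonians under the gluing maps\<close>

lemma sum_keys_superset:
  fixes f :: "'k \<Rightarrow> complex \<Rightarrow> 'b::comm_monoid_add"
  assumes "finite S" "Poly_Mapping.keys P \<subseteq> S" "\<And>m. f m 0 = 0"
  shows "(\<Sum>m\<in>Poly_Mapping.keys P. f m (Poly_Mapping.lookup P m)) =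
         (\<Sum>m\<in>S. f m (Poly_Mapping.lookup P m))"
  by (rule sum.mono_neutral_left) (use assms in \<open>auto simp: in_keys_iff\<close>)

lemma sum_keys_add:
  fixes f :: "'k \<Rightarrow> complex \<Rightarrow> 'b::comm_monoid_add"
  assumes "\<And>m. f m 0 = 0" "\<And>m x y. f m (x + y) = f m x + f m y"
  shows "(\<Sum>m\<in>Poly_Mapping.keys (P + Q). f m (Poly_Mapping.lookup (P + Q) m)) =
         (\<Sum>m\<in>Poly_Mapping.keys P. f m (Poly_Mapping.lookup P m)) +
         (\<Sum>m\<in>Poly_Mapping.keys Q. f m (Poly_Mapping.lookup Q m))"
proof -
  let ?S = "Poly_Mapping.keys P \<union> Poly_Mapping.keys Q"
  have s: "finite ?S" "Poly_Mapping.keys P \<subseteq> ?S" "Poly_Mapping.keys Q \<subseteq> ?S"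
    "Poly_Mapping.keys (P + Q) \<subseteq> ?S"
    using Poly_Mapping.keys_add[of P Q] by auto
  show ?thesis
    unfolding sum_keys_superset[OF s(1) s(4), of f, OF assms(1)]
      sum_keys_superset[OF s(1) s(2), of f, OF assms(1)]
      sum_keys_superset[OF s(1) s(3), of f, OF assms(1)]
    by (simp add: assms lookup_add sum.distrib)
qed

lemma sum_keys_single:
  fixes f :: "'k \<Rightarrow> complex \<Rightarrow> 'b::comm_monoid_add"
  assumes "\<And>m. f m 0 = 0"
  shows "(\<Sum>m\<in>Poly_Mapping.keys (Poly_Mapping.single n x).
            f m (Poly_Mapping.lookup (Poly_Mapping.single n x) m)) = f n x"
  using assms by (cases "x = 0") auto

lemma poly_mapping_single_induct [case_names zero add]:
  fixes P :: "'k \<Rightarrow>\<^sub>0 'b::comm_monoid_add"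
  assumes "Q 0" "\<And>n x P. Q P \<Longrightarrow> Q (Poly_Mapping.single n x + P)"
  shows "Q P"
proof -
  have *: "Q (\<Sum>m\<in>S. Poly_Mapping.single m (Poly_Mapping.lookup P m))" if "finite S" for S
    using that by induction (auto intro: assms)
  have "P = (\<Sum>m\<in>Poly_Mapping.keys P. Poly_Mapping.single m (Poly_Mapping.lookup P m))"
    by (rule poly_mapping_eqI)
      (auto simp: lookup_sum lookup_single when_def sum.delta in_keys_iff)
  then show ?thesis using *[of "Poly_Mapping.keys P"] by simp
qed

lemma cst_hom:
  "cst 0 = 0" "cst 1 = 1" "cst (x + y) = cst x + cst y"
  "cst (x * y) = (cst x * cst y :: 'e::comm_monoid_add poly4)"
  by (simp_all add: cst_def single_add mult_single flip: zero_prod_def)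

lemma pull_fun_add: "pull_fun \<tau> (F + G) = pull_fun \<tau> F + pull_fun \<tau> G"
proof (cases \<tau>)
  case (Pair a b)
  show ?thesis
    unfolding Pair pull_fun_def prod.case
    by (rule sum_keys_add[where f = "\<lambda>m x. case m of (i, j, k, l) \<Rightarrow>
          cst x * a ^ i * b ^ j * vt ^ k * vc ^ l"])
      (auto simp: cst_hom algebra_simps)
qed

lemma pull_fun_single:
  "pull_fun (a, b) (Poly_Mapping.single (i, j, k, l) x) = cst x * a ^ i * b ^ j * vt ^ k * vc ^ l"
  unfolding pull_fun_def prod.case
  by (subst sum_keys_single[where f = "\<lambda>m x. case m of (i, j, k, l) \<Rightarrow>
          cst x * a ^ i * b ^ j * vt ^ k * vc ^ l"])
    (auto simp: cst_hom)

lemma pull_fun_zero: "pull_fun \<tau> 0 = 0"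
  by (simp add: pull_fun_def split: prod.split)

lemma pull_fun_mult: "pull_fun \<tau> (F * G) = pull_fun \<tau> F * pull_fun \<tau> G"
proof (cases \<tau>)
  case (Pair a b)
  have *: "pull_fun \<tau> (Poly_Mapping.single n x * G) =
      pull_fun \<tau> (Poly_Mapping.single n x) * pull_fun \<tau> G" for n x
  proof (induction G rule: poly_mapping_single_induct)
    case (add m y P)
    have "pull_fun \<tau> (Poly_Mapping.single n x * Poly_Mapping.single m y) =
      pull_fun \<tau> (Poly_Mapping.single n x) * pull_fun \<tau> (Poly_Mapping.single m y)"
      by (cases n; cases m)
        (simp add: Pair mult_single pull_fun_single cst_hom power_add mult_ac)
    with add show ?case
      by (simp add: distrib_left pull_fun_add)
  qed (simp add: pull_fun_zero)
  show ?thesis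
    by (induction F rule: poly_mapping_single_induct)
      (simp_all add: pull_fun_zero pull_fun_add distrib_right *)
qed

lemma pull_fun_one: "pull_fun \<tau> 1 = 1"
  using pull_fun_single[of "fst \<tau>" "snd \<tau>" 0 0 0 0 1]
  by (simp add: cst_hom flip: zero_prod_def)

lemma pull_fun_uminus: "pull_fun \<tau> (- F) = - pull_fun \<tau> F"
  using pull_fun_add[of \<tau> F "- F"] by (simp add: pull_fun_zero eq_neg_iff_add_eq_0 add.commute)

lemma pull_fun_diff: "pull_fun \<tau> (F - G) = pull_fun \<tau> F - pull_fun \<tau> G"
  using pull_fun_add[of \<tau> F "- G"] by (simp add: pull_fun_uminus)

lemma pull_fun_power: "pull_fun \<tau> (F ^ n) = pull_fun \<tau> F ^ n"
  by (induction n) (simp_all add: pull_fun_one pull_fun_mult)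

lemma pull_fun_gens:
  "pull_fun (a, b) vy = a" "pull_fun (a, b) vz = b" "pull_fun (a, b) vt = vt"
  "pull_fun (a, b) vc = vc" "pull_fun (a, b) (cst x) = cst x"
  by (simp_all add: vy_def[where 'e = nat] vz_def[where 'e = nat] vt_def[where 'e = nat]
      vc_def[where 'e = nat] cst_def[where 'e = nat] pull_fun_single cst_hom)

lemmas pull_fun_hom = pull_fun_zero pull_fun_one pull_fun_add pull_fun_mult pull_fun_uminus
  pull_fun_diff pull_fun_power pull_fun_gens

lemma vy_inv_vy: "vy * inv_vy = 1"
  by (simp add: vy_def inv_vy_def mult_single flip: zero_prod_def)

lemma single_power:
  "Poly_Mapping.single (i, 0, 0, 0) 1 ^ n = (Poly_Mapping.single (of_nat n * i, 0, 0, 0) 1 :: overlap_ring)"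
  "Poly_Mapping.single (0, 1, 0, 0) 1 ^ n = (Poly_Mapping.single (0, n, 0, 0) 1 :: overlap_ring)"
  "Poly_Mapping.single (0, 0, 1, 0) 1 ^ n = (Poly_Mapping.single (0, 0, n, 0) 1 :: overlap_ring)"
  "Poly_Mapping.single (0, 0, 0, 1) 1 ^ n = (Poly_Mapping.single (0, 0, 0, n) 1 :: overlap_ring)"
  by (induction n, simp_all add: mult_single distrib_right, simp_all flip: zero_prod_def)

lemma lookup_pull_fun_incl:
  "Poly_Mapping.lookup (pull_fun incl F) (int i, j, k, l) = Poly_Mapping.lookup F (i, j, k, l)"
proof (induction F rule: poly_mapping_single_induct)
  case (add n x P)
  obtain i' j' k' l' where n: "n = (i', j', k', l')" by (cases n)
  have "pull_fun incl (Poly_Mapping.single n x) = Poly_Mapping.single (int i', j', k', l') x"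
    by (simp add: n incl_def pull_fun_single vy_def vz_def vt_def vc_def cst_def
        single_power[unfolded One_nat_def] mult_single)
  then show ?case
    using add by (simp add: pull_fun_add lookup_add n lookup_single when_def)
qed (simp add: pull_fun_zero)

lemma pull_fun_incl_eq_iff: "pull_fun incl F = pull_fun incl G \<longleftrightarrow> F = G"
  by (metis lookup_pull_fun_incl poly_mapping_eqI prod_cases4)

lemma cst_half: "2 * cst (1 / 2) = (1 :: ('e::comm_monoid_add) poly4)"
proof -
  have "2 * cst (1 / 2) = (cst (1 / 2 + 1 / 2) :: 'e poly4)"
    unfolding cst_hom(3) by (rule mult_2)
  then show ?thesis by (simp add: cst_hom(2))
qed

lemma H3_identity:
  fixes y z t c u h :: "'a::comm_ring_1"
  assumes "y * u = 1"
  defines "w \<equiv> y * (c - y * z)"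
  shows "- z + h * w ^ 2 + h * t * w = u ^ 2 * w + h * w ^ 2 + h * t * w - c * u"
proof -
  have "u ^ 2 * w = (y * u) * (c * u) - (y * u) ^ 2 * z"
    by (simp add: w_def power2_eq_square algebra_simps)
  then show ?thesis by (simp add: assms)
qed

lemma H12_identity:
  fixes y z t c u h :: "'a::comm_ring_1"
  assumes u: "y * u = 1" and h: "2 * h = 1"
  defines "w \<equiv> y * (c + 1 + y * z)"
  defines "z3 \<equiv> z + (2 * c + 1) * u + t * u ^ 2 + 2 * u ^ 4"
  shows "z + h * w ^ 2 + h * t * w =
    - z3 + h * (y * (c - y * z3)) ^ 2 + h * t * (y * (c - y * z3)) - u"
proof -
  have v: "y * (c - y * z3) = y * c - y ^ 2 * z - (2 * c + 1) * y * (y * u)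
      - t * (y * u) ^ 2 - 2 * (y * u) ^ 2 * u ^ 2"
    by (simp add: z3_def power2_eq_square power4_eq_xxxx algebra_simps)
  have v: "y * (c - y * z3) = - w - t - 2 * u ^ 2"
    unfolding v u by (simp add: w_def power2_eq_square algebra_simps)
  have "w * u ^ 2 = (y * u) * ((c + 1) * u) + (y * u) ^ 2 * z"
    by (simp add: w_def power2_eq_square algebra_simps)
  then have wu: "w * u ^ 2 = (c + 1) * u + z" by (simp add: u)
  have "h * (- w - t - 2 * u ^ 2) ^ 2 + h * t * (- w - t - 2 * u ^ 2) =
      h * w ^ 2 + h * t * w + (2 * h) * (2 * (w * u ^ 2) + t * u ^ 2 + 2 * u ^ 4)"
    by (simp add: power2_eq_square power4_eq_xxxx algebra_simps)
  then have "h * (- w - t - 2 * u ^ 2) ^ 2 + h * t * (- w - t - 2 * u ^ 2) =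
      h * w ^ 2 + h * t * w + 2 * ((c + 1) * u + z) + t * u ^ 2 + 2 * u ^ 4"
    by (simp only: h wu) simp
  then show ?thesis unfolding v by (simp add: z3_def algebra_simps)
qed

lemma H3_substitution: "pull_fun incl H3 = pull_fun trans_3_1 H1"
  unfolding H3_def H1_def incl_def trans_3_1_def pull_fun_hom
  by (rule H3_identity[OF vy_inv_vy])

lemma H12_substitution: "pull_fun incl H12 = pull_fun trans_12_3 H3 - inv_vy"
  unfolding H3_def H12_def incl_def trans_12_3_def pull_fun_hom
  by (rule H12_identity[OF vy_inv_vy cst_half])

lemma pull_fun_trans_12_1_H1: "pull_fun trans_12_1 H1 = pull_fun trans_12_3 H3"
proof -
  have *: "vy * (- (vc + 1) - vy * vz) - 2 * inv_vy ^ 2 - vt =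
    vy * (vc - vy * (vz + (2 * vc + 1) * inv_vy + vt * inv_vy ^ 2 + 2 * inv_vy ^ 4))"
    (is "?l = ?r")
  proof -
    have *: "?r = vy * vc - vy ^ 2 * vz - (2 * vc + 1) * vy * (vy * inv_vy)
        - vt * (vy * inv_vy) ^ 2 - 2 * (vy * inv_vy) ^ 2 * inv_vy ^ 2"
      by (simp add: power2_eq_square power4_eq_xxxx algebra_simps)
    show ?thesis unfolding * vy_inv_vy by (simp add: power2_eq_square algebra_simps)
  qed
  show ?thesis
    unfolding H1_def H3_def trans_12_1_def trans_12_3_def pull_fun_hom *
    by (rule H3_identity[OF vy_inv_vy, symmetric])
qed

lemma pderiv_along_add:
  "pderiv_along w s (F + G) = pderiv_along w s F + pderiv_along w s G"
  unfolding pderiv_along_def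
  by (rule sum_keys_add[where f = "\<lambda>m x. Poly_Mapping.single (m - s) (w m * x)"])
    (auto simp: algebra_simps single_add)

lemma pderiv_along_single:
  "pderiv_along w s (Poly_Mapping.single m x) = Poly_Mapping.single (m - s) (w m * x)"
  unfolding pderiv_along_def
  by (rule sum_keys_single[where f = "\<lambda>m x. Poly_Mapping.single (m - s) (w m * x)"]) auto

lemma pderiv_along_mult:
  fixes w :: "'e::{cancel_comm_monoid_add} \<times> nat \<times> nat \<times> nat \<Rightarrow> complex"
  assumes add: "\<And>m n. w (m + n) = w m + w n"
    and shift: "\<And>m n. w m \<noteq> 0 \<Longrightarrow> (m + n) - s = (m - s) + n"
  shows "pderiv_along w s (F * G) = pderiv_along w s F * G + F * pderiv_along w s G"
proof -
  have single: "pderiv_along w s (Poly_Mapping.single n x * Poly_Mapping.single m y) =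
      pderiv_along w s (Poly_Mapping.single n x) * Poly_Mapping.single m y
      + Poly_Mapping.single n x * pderiv_along w s (Poly_Mapping.single m y)" for n x m y
  proof -
    have "Poly_Mapping.single (n + m - s) (w n * (x * y))
        = Poly_Mapping.single ((n - s) + m) (w n * (x * y))"
      using shift[of n m] by (cases "w n = 0") auto
    moreover have "Poly_Mapping.single (n + m - s) (w m * (x * y))
        = Poly_Mapping.single (n + (m - s)) (w m * (x * y))"
      using shift[of m n] by (cases "w m = 0") (auto simp: add.commute)
    ultimately show ?thesis
      unfolding mult_single pderiv_along_single add distrib_right single_add
      by (simp add: mult_ac)
  qed
  have zero: "pderiv_along w s 0 = 0" by (simp add: pderiv_along_def)
  have *: "pderiv_along w s (Poly_Mapping.single n x * G) =
      pderiv_along w s (Poly_Mapping.single n x) * G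
      + Poly_Mapping.single n x * pderiv_along w s G" for n x
    by (induction G rule: poly_mapping_single_induct)
      (simp_all add: zero distrib_left pderiv_along_add single)
  show ?thesis
    by (induction F rule: poly_mapping_single_induct)
      (simp_all add: zero distrib_left distrib_right pderiv_along_add *)
qed

lemma d_overlap_mult: "d_overlap (F * G) = (G *\<^sub>f d_overlap F) + (F *\<^sub>f d_overlap G)"
  unfolding differential_def scale_form_def prod.case
  by (subst (1 2 3) pderiv_along_mult) (auto simp: mult_ac split: prod.splits)

lemma d_overlap_add: "d_overlap (F + G) = d_overlap F + d_overlap G"
  by (simp add: differential_def pderiv_along_add)

lemma single_origin: "Poly_Mapping.single (0, 0, 0, 0) 1 = (1 :: ('e::comm_monoid_add) poly4)"
  by (simp flip: zero_prod_def)

lemma d_overlap_gens: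
  "d_overlap vy = (1, 0, 0)" "d_overlap vz = (0, 1, 0)" "d_overlap vt = (0, 0, 1)"
  "d_overlap vc = 0" "d_overlap (cst x) = 0" "d_overlap inv_vy = (- (inv_vy ^ 2), 0, 0)"
  by (auto simp: differential_def vy_def vz_def vt_def vc_def cst_def inv_vy_def
      pderiv_along_single zero_prod_def mult_single power2_eq_square single_uminus single_origin)

lemma d_chart_gens: "d_chart vy = (1, 0, 0)" "d_chart vz = (0, 1, 0)" "d_chart vt = (0, 0, 1)"
  by (auto simp: differential_def vy_def vz_def vt_def pderiv_along_single zero_prod_def
      single_origin)

lemma d_overlap_power: "d_overlap (F ^ n) = (cst (of_nat n) * F ^ (n - 1)) *\<^sub>f d_overlap F"
proof (induction n)
  case 0
  show ?case
    using d_overlap_gens(5)[of 1] by (cases "d_overlap F") (simp add: cst_hom scale_form_def zero_prod_def)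
next
  case (Suc n)
  have "F * (cst (of_nat n) * F ^ (n - 1)) = cst (of_nat n) * F ^ n"
    by (cases n) (simp_all add: cst_hom)
  then have "F *\<^sub>f ((cst (of_nat n) * F ^ (n - 1)) *\<^sub>f d_overlap F) =
      (cst (of_nat n) * F ^ n) *\<^sub>f d_overlap F"
    by (cases "d_overlap F") (simp add: scale_form_def flip: mult.assoc)
  then show ?case
    by (cases "d_overlap F") (simp add: d_overlap_mult Suc, simp add: scale_form_def cst_hom algebra_simps)
qed

lemma d_overlap_pull_fun:
  assumes "d_chart F = (p, q, r)"
  shows "d_overlap (pull_fun (a, b) F) =
    (pull_fun (a, b) p *\<^sub>f d_overlap a) + (pull_fun (a, b) q *\<^sub>f d_overlap b) +
    (pull_fun (a, b) r *\<^sub>f d_overlap vt)"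
  using assms
proof (induction F arbitrary: p q r rule: poly_mapping_single_induct)
  case zero
  then show ?case
    using d_overlap_gens(5)[of 0]
    by (auto simp: differential_def pderiv_along_def pull_fun_zero cst_hom scale_form_def
        zero_prod_def split: prod.splits)
next
  case (add n x P)
  obtain i j k l where n: "n = (i, j, k, l)" by (cases n)
  have "d_overlap (pull_fun (a, b) (Poly_Mapping.single n x)) =
    (pull_fun (a, b) (Poly_Mapping.single (i - 1, j, k, l) (of_nat i * x)) *\<^sub>f d_overlap a) +
    (pull_fun (a, b) (Poly_Mapping.single (i, j - 1, k, l) (of_nat j * x)) *\<^sub>f d_overlap b) +
    (pull_fun (a, b) (Poly_Mapping.single (i, j, k - 1, l) (of_nat k * x)) *\<^sub>f d_overlap vt)"
    unfolding n pull_fun_single d_overlap_mult d_overlap_power d_overlap_gens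
    by (cases "d_overlap a"; cases "d_overlap b")
      (simp add: scale_form_def zero_prod_def cst_hom algebra_simps)
  moreover obtain p' q' r' where P: "d_chart P = (p', q', r')" by (cases "d_chart P")
  ultimately show ?case
    using add.prems unfolding pull_fun_add d_overlap_add add.IH[OF P]
    using P by (cases "d_overlap a"; cases "d_overlap b"; cases "d_overlap (vt :: overlap_ring)")
      (auto simp: differential_def pderiv_along_add pderiv_along_single n pull_fun_add
        scale_form_def algebra_simps)
qed

lemma pull_hamiltonian_form:
  "pull_form (a, b) (hamiltonian_form H) =
    (d_overlap a \<and>\<^sub>f d_overlap b) + (d_overlap (pull_fun (a, b) H) \<and>\<^sub>f d_overlap vt)"
proof -
  obtain p q r where H: "d_chart H = (p, q, r)" by (cases "d_chart H")
  show ?thesis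
    unfolding hamiltonian_form_def d_overlap_pull_fun[OF H] H d_chart_gens
    by (cases "d_overlap a"; cases "d_overlap b")
      (simp add: d_overlap_gens scale_form_def wedge_def pull_form_def pull_fun_hom algebra_simps)
qed

lemma d_overlap_uminus: "d_overlap (- F) = - d_overlap F"
  using d_overlap_add[of F "- F"] d_overlap_gens(5)[of 0]
  by (simp add: cst_hom eq_neg_iff_add_eq_0 add.commute)

lemma d_overlap_diff: "d_overlap (F - G) = d_overlap F - d_overlap G"
  using d_overlap_add[of F "- G"] by (simp add: d_overlap_uminus)

lemma d_overlap_const: "d_overlap 1 = 0" "d_overlap 2 = 0"
  using d_overlap_gens(5)[of 1] d_overlap_gens(5)[of 2]
  by (simp_all add: cst_def flip: zero_prod_def)

lemma hamiltonian_forms_glue: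
  "glue_together (hamiltonian_form H1) (hamiltonian_form H3) (hamiltonian_form H12)"
proof -
  note d = d_overlap_mult d_overlap_add d_overlap_diff d_overlap_uminus d_overlap_power
    d_overlap_const d_overlap_gens
  have y: "inv_vy ^ 2 * vy ^ 2 = 1"
    using vy_inv_vy by (simp add: mult.commute flip: power_mult_distrib)
  have "pull_form trans_3_1 (hamiltonian_form H1) = pull_form incl (hamiltonian_form H3)"
  proof -
    have "d_overlap (fst trans_3_1) \<and>\<^sub>f d_overlap (snd trans_3_1) =
        d_overlap (fst incl) \<and>\<^sub>f d_overlap (snd incl)"
      by (simp add: trans_3_1_def incl_def d,
          simp add: scale_form_def wedge_def zero_prod_def y flip: power2_eq_square)
    then show ?thesis
      using pull_hamiltonian_form[of "fst trans_3_1" "snd trans_3_1" H1]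
        pull_hamiltonian_form[of "fst incl" "snd incl" H3]
      by (simp add: H3_substitution)
  qed
  moreover have "pull_form trans_12_1 (hamiltonian_form H1) = pull_form incl (hamiltonian_form H12)"
  proof -
    have "d_overlap (fst trans_12_1) \<and>\<^sub>f d_overlap (snd trans_12_1) =
        (d_overlap (fst incl) \<and>\<^sub>f d_overlap (snd incl)) - (d_overlap inv_vy \<and>\<^sub>f d_overlap vt)"
      by (simp add: trans_12_1_def incl_def d,
          simp add: scale_form_def wedge_def zero_prod_def y flip: power2_eq_square)
    then show ?thesis
      using pull_hamiltonian_form[of "fst trans_12_1" "snd trans_12_1" H1]
        pull_hamiltonian_form[of "fst incl" "snd incl" H12]
      by (cases "d_overlap (pull_fun trans_12_3 H3)")
        (simp add: H12_substitution pull_fun_trans_12_1_H1 d_overlap_diff, 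
         simp add: wedge_def d_overlap_gens)
  qed
  moreover have "pull_form trans_12_3 (hamiltonian_form H3) = pull_form incl (hamiltonian_form H12)"
  proof -
    have "d_overlap (fst trans_12_3) \<and>\<^sub>f d_overlap (snd trans_12_3) =
        (d_overlap (fst incl) \<and>\<^sub>f d_overlap (snd incl)) - (d_overlap inv_vy \<and>\<^sub>f d_overlap vt)"
      by (simp add: trans_12_3_def incl_def d,
          simp add: scale_form_def wedge_def zero_prod_def flip: power2_eq_square)
    then show ?thesis
      using pull_hamiltonian_form[of "fst trans_12_3" "snd trans_12_3" H3]
        pull_hamiltonian_form[of "fst incl" "snd incl" H12]
      by (cases "d_overlap (pull_fun trans_12_3 H3)")
        (simp add: H12_substitution d_overlap_diff, 
         simp add: wedge_def d_overlap_gens)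
  qed
  ultimately show ?thesis by (simp add: glue_together_def)
qed

end

(* Subtracting the glueing conditions for H and H' turns them into the statement that
   D = H - H' is, up to functions of t and c, a global regular function, so one has to show
   that every global function lies in C[t,c].  Give y1, z1 the weights 1, 2 and t, c the
   weight 0, i.e. put y1 = r, z1 = r^2 w and expand in 1/r.  The top coefficient, at
   weight n, of a global function is a polynomial in w of degree at most n/2 (chart 1)
   divisible by the powers of w (chart 3) and w + 2 (chart 12) with exponent at least n/4.  Hence
   n = 4m and the coefficient is a (w (w + 2))^m, which is that of a (2 H1)^m.  Now 2 H1 is
   regular on charts 1 and 3, but on chart 12 only after subtraction of 2r.  After
   subtracting a (2 H1)^m the next possible weight is 4m - 3, where the defect
   2 a m r (2 H1)^(m-1) would have to cancel, and the same degree count forces a = 0. *)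

theory Submission
  imports Defs "HOL-Computational_Algebra.Formal_Laurent_Series"
begin

notation fls_nth (infixl "$$" 75)

section \<open>Leading terms of Laurent series\<close>

text \<open>Series are expanded in \<open>1 / r\<close>: the coefficient of \<open>r\<^sup>n\<close> has index \<open>- n\<close>, and
  \<open>fls_X_inv\<close> is \<open>r\<close>.  The top coefficient \<open>a\<close> is allowed to vanish.\<close>

definition top_term :: "'a::comm_ring_1 fls \<Rightarrow> int \<Rightarrow> 'a \<Rightarrow> bool"
  where "top_term f n a \<longleftrightarrow> (\<forall>m < - n. f $$ m = 0) \<and> f $$ (- n) = a"

text \<open>Such a series is r^n times a power series in 1/r, so multiplicativity of top
  coefficients reduces to that of constant coefficients.\<close>

lemma top_term_conv_fps:
  "top_term f n a \<longleftrightarrow> (\<exists>F. f = fls_shift n (fps_to_fls F) \<and> fps_nth F 0 = a)"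
proof
  assume f: "top_term f n a"
  show "\<exists>F. f = fls_shift n (fps_to_fls F) \<and> fps_nth F 0 = a"
  proof (intro exI conjI)
    show "f = fls_shift n (fps_to_fls (Abs_fps (\<lambda>k. f $$ (int k - n))))"
      using f by (auto simp: fls_eq_iff top_term_def)
    show "fps_nth (Abs_fps (\<lambda>k. f $$ (int k - n))) 0 = a"
      using f by (simp add: top_term_def)
  qed
qed (auto simp: top_term_def)

lemma top_term_mult:
  assumes "top_term f n a" "top_term g m b"
  shows "top_term (f * g) (n + m) (a * b)"
proof -
  obtain F G where "f = fls_shift n (fps_to_fls F)" "fps_nth F 0 = a"
    "g = fls_shift m (fps_to_fls G)" "fps_nth G 0 = b"
    using assms by (auto simp: top_term_conv_fps)
  then have "f * g = fls_shift (n + m) (fps_to_fls (F * G))" "fps_nth (F * G) 0 = a * b"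
    by (simp_all add: fls_times_both_shifted_simp fls_times_fps_to_fls)
  then show ?thesis by (auto simp: top_term_conv_fps)
qed

lemma top_term_const: "top_term (fls_const a) 0 a"
  by (simp add: top_term_def)

lemma top_term_X: "top_term fls_X (- 1) 1"
  by (simp add: top_term_def)

lemma top_term_X_inv: "top_term fls_X_inv 1 1"
  by (simp add: top_term_def)

lemma top_term_power:
  assumes "top_term f n a"
  shows "top_term (f ^ k) (int k * n) (a ^ k)"
proof (induction k)
  case (Suc k)
  show ?case using top_term_mult[OF assms Suc] by (simp add: algebra_simps)
qed (use top_term_const[of 1] in simp)

lemma top_term_add:
  "top_term f n a \<Longrightarrow> top_term g n b \<Longrightarrow> top_term (f + g) n (a + b)"
  by (simp add: top_term_def)

lemma top_term_diff:
  "top_term f n a \<Longrightarrow> top_term g n b \<Longrightarrow> top_term (f - g) n (a - b)"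
  by (simp add: top_term_def)

lemma top_term_sum:
  "(\<And>i. i \<in> S \<Longrightarrow> top_term (f i) n (a i)) \<Longrightarrow> top_term (sum f S) n (sum a S)"
  by (induction S rule: infinite_finite_induct) (auto intro: top_term_add simp: top_term_def)

lemma top_term_raise: "top_term f n a \<Longrightarrow> n < m \<Longrightarrow> top_term f m 0"
  by (simp add: top_term_def)

lemma top_term_lower:
  assumes "top_term f n 0"
  shows "top_term f (n - 1) (f $$ (1 - n))"
proof -
  have "f $$ m = 0" if "m < 1 - n" for m
  proof (cases "m = - n")
    case False
    then have "m < - n" using that by simp
    then show ?thesis using assms by (simp add: top_term_def)
  qed (use assms in \<open>simp add: top_term_def\<close>)
  then show ?thesis by (simp add: top_term_def)
qed

section \<open>Subalgebras of regular functions\<close>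

text \<open>The ring of scalars will be the functions of t and c, while the coefficients of a series
  are polynomials in w over it. Hence \<open>range scal\<close> consists of the functions free of
  both r and w.\<close>

definition scal :: "'k::comm_ring_1 \<Rightarrow> 'k poly fls"
  where "scal k = fls_const [:k:]"

lemma scal_hom:
  "scal 0 = 0" "scal 1 = 1" "scal (x + y) = scal x + scal y"
  "scal (- x) = - scal x" "scal (x * y) = scal x * scal y"
  unfolding scal_def fls_const_mult_const fls_plus_const fls_const_uminus[symmetric]
  by (simp_all add: mult.commute flip: one_pCons)

lemma top_term_scal: "top_term (scal k) 0 [:k:]"
  unfolding scal_def by (rule top_term_const)

text \<open>The coordinate \<open>w = z\<^sub>1 / y\<^sub>1\<^sup>2\<close>.\<close>

abbreviation W :: "'k::idom poly fls" where "W \<equiv> fls_const [:0, 1:]"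

text \<open>In the coordinates r, w the monomial y_1^i z_1^j is a single term, of weight i + 2 j and
  w-exponent j. These two numbers recover i and j.\<close>

lemma fls_X_inv_monomial:
  "scal x * (fls_X_inv ^ i * (fls_X_inv ^ 2 * W) ^ j) = fls_X_inv ^ (i + 2 * j) * fls_const (monom x j)"
proof -
  have "fls_const (monom x j) = fls_const [:x:] * fls_const ([:0, 1:] ^ j)"
    by (simp add: monom_altdef fls_const_mult_const)
  then show ?thesis
    unfolding power_add power_mult power_mult_distrib fls_const_power[symmetric] scal_def
    by (simp only: mult_ac)
qed

text \<open>With \<open>Y\<close> and \<open>Z\<close> the expansions of the two coordinates of a
  chart, membership means regularity on that chart.\<close>

inductive_set subalgebra :: "'k::idom poly fls \<Rightarrow> 'k poly fls \<Rightarrow> 'k poly fls set"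
  for Y Z where
    scalar: "scal k \<in> subalgebra Y Z"
  | gen1: "Y \<in> subalgebra Y Z"
  | gen2: "Z \<in> subalgebra Y Z"
  | add: "f \<in> subalgebra Y Z \<Longrightarrow> g \<in> subalgebra Y Z \<Longrightarrow> f + g \<in> subalgebra Y Z"
  | mult: "f \<in> subalgebra Y Z \<Longrightarrow> g \<in> subalgebra Y Z \<Longrightarrow> f * g \<in> subalgebra Y Z"

lemma subalgebra_diff:
  assumes "f \<in> subalgebra Y Z" "g \<in> subalgebra Y Z"
  shows "f - g \<in> subalgebra Y Z"
proof -
  have "f + scal (- 1) * g \<in> subalgebra Y Z"
    using assms by (intro subalgebra.intros)
  then show ?thesis by (simp add: scal_hom)
qed

lemma subalgebra_power: "f \<in> subalgebra Y Z \<Longrightarrow> f ^ n \<in> subalgebra Y Z"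
  using subalgebra.scalar[of 1 Y Z]
  by (induction n) (auto intro: subalgebra.mult simp: scal_hom)

section \<open>Elements of a subalgebra as finite sums of monomials\<close>

definition monomial_sums :: "'k::idom poly fls \<Rightarrow> 'k poly fls \<Rightarrow> 'k poly fls set"
  where "monomial_sums Y Z =
    {\<Sum>(i, j)\<in>S. scal (d (i, j)) * (Y ^ i * Z ^ j) | S d. finite S}"

lemma monomial_sums_monomial: "scal k * (Y ^ i * Z ^ j) \<in> monomial_sums Y Z"
  unfolding monomial_sums_def
  by (rule CollectI, rule exI[of _ "{(i, j)}"], rule exI[of _ "\<lambda>_. k"]) simp

lemma monomial_sums_add:
  assumes "f \<in> monomial_sums Y Z" "g \<in> monomial_sums Y Z"
  shows "f + g \<in> monomial_sums Y Z"
proof -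
  let ?m = "\<lambda>d (i, j). scal (d (i, j)) * (Y ^ i * Z ^ j)"
  obtain S d T e where S: "finite S" "f = sum (?m d) S" and T: "finite T" "g = sum (?m e) T"
    using assms by (auto simp: monomial_sums_def)
  \<comment> \<open>Extension of the coefficients by zero lets both sums run over
    \<open>S \<union> T\<close>.\<close>
  define d' where "d' p = (if p \<in> S then d p else 0)" for p
  define e' where "e' p = (if p \<in> T then e p else 0)" for p
  have "f = sum (?m d') (S \<union> T)" unfolding S
    by (rule sum.mono_neutral_cong_left) (auto simp: S T d'_def scal_hom)
  moreover have "g = sum (?m e') (S \<union> T)" unfolding T
    by (rule sum.mono_neutral_cong_left) (auto simp: S T e'_def scal_hom)
  ultimately have "f + g = sum (?m (\<lambda>p. d' p + e' p)) (S \<union> T)"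
    by (simp add: case_prod_beta scal_hom distrib_right sum.distrib)
  then show ?thesis
    using S(1) T(1) unfolding monomial_sums_def
    by (intro CollectI exI[of _ "S \<union> T"] exI[of _ "\<lambda>p. d' p + e' p"]) simp
qed

lemma monomial_sums_sum:
  "(\<And>i. i \<in> I \<Longrightarrow> f i \<in> monomial_sums Y Z) \<Longrightarrow> sum f I \<in> monomial_sums Y Z"
  using monomial_sums_monomial[of 0 Y 0 Z 0]
  by (induction I rule: infinite_finite_induct) (auto intro: monomial_sums_add simp: scal_hom)

lemma subalgebra_monomial_sums: "f \<in> subalgebra Y Z \<Longrightarrow> f \<in> monomial_sums Y Z"
proof (induction rule: subalgebra.induct)
  case (scalar k)
  then show ?case using monomial_sums_monomial[of k Y 0 Z 0] by simp
next
  case gen1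
  then show ?case using monomial_sums_monomial[of 1 Y 1 Z 0] by (simp add: scal_hom)
next
  case gen2
  then show ?case using monomial_sums_monomial[of 1 Y 0 Z 1] by (simp add: scal_hom)
next
  case (add f g)
  then show ?case by (blast intro: monomial_sums_add)
next
  case (mult f g)
  let ?m = "\<lambda>d (i, j). scal (d (i, j)) * (Y ^ i * Z ^ j)"
  obtain S d T e where "f = sum (?m d) S" "g = sum (?m e) T"
    using mult by (auto simp: monomial_sums_def)
  moreover have "?m d p * ?m e q \<in> monomial_sums Y Z" for p q
    using monomial_sums_monomial[of "d p * e q" Y "fst p + fst q" Z "snd p + snd q"]
    by (simp add: case_prod_beta power_add mult_ac scal_hom)
  ultimately show ?case by (simp add: sum_product monomial_sums_sum)
qed

text \<open>The monomials \<open>r\<^sup>-\<^sup>i Z\<^sup>j\<close> have weight \<open>4 j - i\<close>.  Those of the same weight have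
  different \<open>j\<close>, and powers of \<open>u\<close> are linearly independent, so that the leading terms of highest
  weight cannot cancel.\<close>

lemma subalgebra_top_term_dvd:
  assumes Z: "top_term Z 4 u" and u: "degree u = 1"
    and f: "f \<in> subalgebra fls_X Z" "top_term f n a" and k: "4 * int k \<le> n + 3"
  shows "u ^ k dvd a"
proof -
  obtain S d where S: "finite S" "f = (\<Sum>(i, j)\<in>S. scal (d (i, j)) * (fls_X ^ i * Z ^ j))"
    using subalgebra_monomial_sums[OF f(1)] by (auto simp: monomial_sums_def)
  \<comment> \<open>Without the zero coefficients, every monomial indexed by \<open>T\<close> has a
    nonzero leading term.\<close>
  define T where "T = {p \<in> S. d p \<noteq> 0}"
  define wt where "wt = (\<lambda>p :: nat \<times> nat. 4 * int (snd p) - int (fst p))"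
  define h where "h = (\<lambda>p :: nat \<times> nat. scal (d p) * (fls_X ^ fst p * Z ^ snd p))"
  \<comment> \<open>If \<open>wt p \<le> N\<close>, this is the coefficient of \<open>h p\<close> at
    weight \<open>N\<close>.\<close>
  define c where "c N p = (if wt p = N then [:d p:] * u ^ snd p else 0)" for N p
  have T: "finite T" "f = sum h T"
    using S unfolding T_def h_def case_prod_beta prod.collapse
    by (auto intro!: sum.mono_neutral_right simp: scal_hom)
  have h: "top_term (h p) (wt p) ([:d p:] * u ^ snd p)" for p
    using top_term_mult[OF top_term_scal[of "d p"] top_term_mult[OF top_term_power[OF top_term_X, of "fst p"]
        top_term_power[OF Z, of "snd p"]]]
    by (simp add: h_def wt_def mult.commute)
  have sum: "top_term f N (\<Sum>p\<in>T. c N p)" if "\<And>p. p \<in> T \<Longrightarrow> wt p \<le> N" for N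
    unfolding T(2)
  proof (rule top_term_sum)
    fix p assume "p \<in> T"
    then show "top_term (h p) N (c N p)"
      using that[of p] h[of p] top_term_raise[OF h, of p N] by (auto simp: c_def)
  qed
  show ?thesis
  proof (cases "T = {}")
    case True
    then show ?thesis using T f(2) by (simp add: top_term_def)
  next
    case False
    define N where "N = Max (wt ` T)"
    have N: "wt p \<le> N" if "p \<in> T" for p
      using that T(1) by (simp add: N_def)
    have "N \<in> wt ` T"
      unfolding N_def using T(1) False by (intro Max_in) auto
    then obtain p0 where p0: "p0 \<in> T" "wt p0 = N" by blast
    have "(\<Sum>p\<in>T. c N p) \<noteq> 0"
    proof
      \<comment> \<open>\<open>q\<close> has a variable in place of \<open>u\<close>. Composition
        with \<open>u\<close> is injective because \<open>u\<close> has degree 1, and at weight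
        \<open>N\<close> the exponent \<open>snd p\<close> determines \<open>p\<close>, so the
        coefficient of \<open>q\<close> at \<open>snd p0\<close> is \<open>d p0\<close>
        alone.\<close>
      define q where "q = (\<Sum>p\<in>T. if wt p = N then monom (d p) (snd p) else 0)"
      assume "(\<Sum>p\<in>T. c N p) = 0"
      moreover have monom: "pcompose (monom x j) u = [:x:] * u ^ j" for x j
        by (induction j) (simp_all add: monom_0 monom_Suc pcompose_pCons)
      have "pcompose q u = (\<Sum>p\<in>T. c N p)"
        unfolding q_def pcompose_sum
        by (intro sum.cong) (auto simp: c_def monom)
      ultimately have "q = 0"
        using pcompose_eq_0[of q u] u by simp
      have "coeff q (snd p0) = (\<Sum>p\<in>T. if p = p0 then d p0 else 0)"
        unfolding q_def coeff_sum
        by (intro sum.cong) (use p0 in \<open>auto simp: wt_def prod_eq_iff\<close>)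
      also have "\<dots> = d p0" using T(1) p0 by simp
      finally show False using \<open>q = 0\<close> p0 by (simp add: T_def)
    qed
    then have "f $$ (- N) \<noteq> 0"
      using sum[of N, OF N] by (simp add: top_term_def)
    then have "N \<le> n"
      using f(2) by (force simp: top_term_def)
    then have "a = (\<Sum>p\<in>T. c n p)"
      using sum[of n] order_trans[OF N] f(2) by (simp add: top_term_def)
    moreover have "u ^ k dvd c n p" for p
    proof (cases "wt p = n")
      case True
      \<comment> \<open>Here \<open>4 * snd p \<ge> n \<ge> 4 * k - 3\<close>, and integrality
        absorbs the 3.\<close>
      then have "k \<le> snd p" using k by (simp add: wt_def)
      then show ?thesis using True by (simp add: c_def le_imp_power_dvd dvd_smult)
    qed (simp add: c_def)
    ultimately show ?thesis by (simp add: dvd_sum)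
  qed
qed

text \<open>By \<open>fls_X_inv_monomial\<close> a monomial of weight n = i + 2 j contributes only
  w^j, and j is at most n / 2.\<close>

lemma subalgebra_nonneg:
  fixes f :: "'k::idom poly fls"
  assumes "f \<in> subalgebra fls_X_inv (fls_X_inv ^ 2 * W)"
  shows "m > 0 \<Longrightarrow> f $$ m = 0" "2 * degree (f $$ (- int n)) \<le> n"
proof -
  let ?Z = "fls_X_inv ^ 2 * W :: 'k poly fls"
  obtain S d where S: "finite S" "f = (\<Sum>(i, j)\<in>S. scal (d (i, j)) * (fls_X_inv ^ i * ?Z ^ j))"
    using subalgebra_monomial_sums[OF assms] by (auto simp: monomial_sums_def)
  have nth: "f $$ m = (\<Sum>(i, j)\<in>S. if m = - int (i + 2 * j) then monom (d (i, j)) j else 0)" for m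
    unfolding S(2) fls_nth_sum case_prod_beta fls_X_inv_monomial
    by (intro sum.cong) (auto simp: fls_X_inv_power_times_conv_shift)
  show "f $$ m = 0" if "m > 0"
    unfolding nth using that by (intro sum.neutral) auto
  have "degree (f $$ (- int n)) \<le> n div 2"
    unfolding nth
  proof (rule degree_sum_le[OF S(1)], clarify)
    fix i j
    show "degree (if - int n = - int (i + 2 * j) then monom (d (i, j)) j else 0) \<le> n div 2"
      using degree_monom_le[of "d (i, j)" j] by auto
  qed
  then show "2 * degree (f $$ (- int n)) \<le> n" by simp
qed


section \<open>Polynomials divisible by powers of two distinct linear factors\<close>

lemma two_root_powers_dvd:
  fixes p :: "'k::idom poly"
  assumes "[:- a, 1:] ^ i dvd p" "[:- b, 1:] ^ j dvd p" "a \<noteq> b"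
  shows "[:- a, 1:] ^ i * [:- b, 1:] ^ j dvd p"
proof (cases "p = 0")
  case False
  obtain q where q: "p = [:- a, 1:] ^ i * q"
    using assms(1) by blast
  \<comment> \<open>The first factor does not vanish at \<open>b\<close>, so the whole order of
    \<open>p\<close> at \<open>b\<close> comes from \<open>q\<close>.\<close>
  have "order b p = order b ([:- a, 1:] ^ i) + order b q"
    unfolding q by (rule order_mult) (use False q in simp)
  also have "order b ([:- a, 1:] ^ i) = 0"
    by (rule order_0I) (use assms(3) in simp)
  finally have "[:- b, 1:] ^ j dvd q"
    using assms(2) False by (simp add: order_divides)
  then show ?thesis unfolding q by (rule mult_dvd_mono[OF dvd_refl])
qed simp

lemma two_root_powers_degree:
  fixes p :: "'k::idom poly"
  assumes "[:- a, 1:] ^ i dvd p" "[:- b, 1:] ^ j dvd p" "a \<noteq> b" "p \<noteq> 0"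
  shows "i + j \<le> degree p"
proof -
  have "degree ([:- a, 1:] ^ i * [:- b, 1:] ^ j) = i + j"
    by (subst degree_mult_eq) (simp_all add: degree_linear_power)
  then show ?thesis
    using dvd_imp_degree_le[OF two_root_powers_dvd[OF assms(1-3)] assms(4)] by simp
qed

section \<open>Global functions are constant\<close>

text \<open>\<open>f\<close> plays the global function and \<open>g\<close> plays 2 H_1. Charts 3
  and 12 enter only through the leading terms of \<open>Z3\<close> and \<open>Z12\<close>.
  Characteristic 0 keeps the factor 2 m of the defect nonzero.\<close>

lemma subalgebra_inter_scalar:
  fixes f g Z3 Z12 :: "'k::{idom, ring_char_0} poly fls"
  defines "Z1 \<equiv> fls_X_inv ^ 2 * W"
  assumes Z3: "top_term Z3 4 [:0, - 1:]" and Z12: "top_term Z12 4 [:- 2, - 1:]"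
    and f: "f \<in> subalgebra fls_X_inv Z1" "f \<in> subalgebra fls_X Z3" "f \<in> subalgebra fls_X Z12"
    and g: "g \<in> subalgebra fls_X_inv Z1" "g \<in> subalgebra fls_X Z3"
      "g - 2 * fls_X_inv \<in> subalgebra fls_X Z12"
    and top_g: "top_term g 4 ([:0, 1:] * [:2, 1:])"
  shows "f \<in> range scal"
proof (rule ccontr)
  assume nonscalar: "f \<notin> range scal"
  let ?U = "[:0, 1:] :: 'k poly" and ?V = "[:2, 1:] :: 'k poly"
  have nonneg: "i > 0 \<Longrightarrow> h $$ i = 0" "2 * degree (h $$ (- int n)) \<le> n"
    if "h \<in> subalgebra fls_X_inv Z1" for h i n
    using subalgebra_nonneg[of h] that unfolding Z1_def by blast+
  have uminus: "?U dvd [:0, - 1:]" "?V dvd [:- 2, - 1:]"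
    by (rule dvdI[of _ _ "- 1"], simp)+
  have dvd3: "?U ^ k dvd b" if "h \<in> subalgebra fls_X Z3" "top_term h n b" "4 * int k \<le> n + 3" for h n b k
    using dvd_trans[OF dvd_power_same[OF uminus(1)] subalgebra_top_term_dvd[OF Z3 _ that]] by simp
  have dvd12: "?V ^ k dvd b" if "h \<in> subalgebra fls_X Z12" "top_term h n b" "4 * int k \<le> n + 3" for h n b k
    using dvd_trans[OF dvd_power_same[OF uminus(2)] subalgebra_top_term_dvd[OF Z12 _ that]] by simp
  note two_dvd = two_root_powers_dvd[of 0 _ _ "- 2 :: 'k", simplified]
  note two_degree = two_root_powers_degree[of 0 _ _ "- 2 :: 'k", simplified]
  have degree1: "degree b * 2 \<le> n" if "h \<in> subalgebra fls_X_inv Z1" "top_term h (int n) b" for h n b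
    using nonneg(2)[OF that(1), of n] that(2) by (simp add: top_term_def mult.commute)

  have "f \<noteq> 0" using nonscalar scal_hom(1) by (metis rangeI)
  \<comment> \<open>No positive powers of 1/r occur in \<open>f\<close>, so the subdegree is at most
    0 and \<open>nat\<close> loses nothing.\<close>
  define n where "n = nat (- fls_subdegree f)"
  have "fls_subdegree f \<le> 0"
    using nonneg(1)[OF f(1), of "fls_subdegree f"] \<open>f \<noteq> 0\<close> by force
  then have n: "fls_subdegree f = - int n" by (simp add: n_def)
  define a where "a = f $$ (- int n)"
  have a: "top_term f (int n) a" "a \<noteq> 0"
    using \<open>f \<noteq> 0\<close> nth_fls_subdegree_nonzero[of f]
    by (auto simp: top_term_def a_def n fls_eq0_below_subdegree)
  have "n > 0"
  proof (rule ccontr)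
    assume "\<not> n > 0"
    then have top: "top_term f 0 a" and "degree a = 0" using a(1) degree1[OF f(1) a(1)] by auto
    then obtain k where "a = [:k:]" by (auto elim: degree_eq_zeroE)
    then have "f = scal k"
      using top nonneg(1)[OF f(1)] by (auto simp: fls_eq_iff top_term_def scal_def)
         (metis linorder_neqE_linordered_idom)
    then show False using nonscalar by blast
  qed
  \<comment> \<open>This is n / 4 rounded up, the largest exponent that \<open>dvd3\<close> and
    \<open>dvd12\<close> admit. Then \<open>4 * m \<le> 2 * degree a \<le> n \<le> 4 * m\<close>
    forces equality throughout.\<close>
  define m where "m = (n + 3) div 4"
  have m: "4 * int m \<le> int n + 3" unfolding m_def by linarith
  note a_dvd = dvd3[OF f(2) a(1) m] dvd12[OF f(3) a(1) m]
  have "m + m \<le> degree a"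
    by (rule two_degree[OF a_dvd a(2)])
  then have nm: "n = 4 * m" "degree a = 2 * m"
    using degree1[OF f(1) a(1)] unfolding m_def by linarith+
  have "m > 0" using nm \<open>n > 0\<close> by simp
  obtain q where q: "a = ?U ^ m * ?V ^ m * q"
    using two_dvd[OF a_dvd] by blast
  then have "q \<noteq> 0" using a(2) by auto
  then have "degree q = 0"
    using nm(2) unfolding q by (simp add: degree_mult_eq degree_linear_power)
  then obtain \<alpha> where \<alpha>: "q = [:\<alpha>:]" by (auto elim: degree_eq_zeroE)

  define h where "h = g - 2 * fls_X_inv"
  define F where "F = f - scal \<alpha> * g ^ m"
  define \<delta> where "\<delta> = scal \<alpha> * (g ^ m - h ^ m)"
  have two: "2 * fls_X_inv = (fls_const 2 * fls_X_inv :: 'k poly fls)" by simp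
  have top2: "top_term (2 * fls_X_inv :: 'k poly fls) 1 2"
    unfolding two using top_term_mult[OF top_term_const[of 2] top_term_X_inv] by simp
  have top_h: "top_term h 4 (?U * ?V)"
    unfolding h_def using top_term_diff[OF top_g top_term_raise[OF top2, of 4]] by simp
  \<comment> \<open>\<open>g ^ m - h ^ m\<close> is \<open>g - h\<close> = 2 r, of weight 1, times a
    sum of \<open>m\<close> products of weight 4 (m - 1) with equal top coefficients.\<close>
  define e where "e = [:\<alpha>:] * (2 * (of_nat m * (?U * ?V) ^ (m - 1)))"
  have top_\<delta>: "top_term \<delta> (4 * int m - 3) e"
  proof -
    have eq: "g ^ m - h ^ m = 2 * fls_X_inv * (\<Sum>i<m. h ^ (m - Suc i) * g ^ i)"
      unfolding power_diff_sumr2 by (simp add: h_def)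
    have sum: "top_term (\<Sum>i<m. h ^ (m - Suc i) * g ^ i) (4 * int (m - 1)) (\<Sum>i<m. (?U * ?V) ^ (m - 1))"
    proof (rule top_term_sum)
      fix i assume "i \<in> {..<m}"
      then have "m - Suc i + i = m - 1" by auto
      then show "top_term (h ^ (m - Suc i) * g ^ i) (4 * int (m - 1)) ((?U * ?V) ^ (m - 1))"
        using top_term_mult[OF top_term_power[OF top_h, of "m - Suc i"] top_term_power[OF top_g, of i]]
        by (simp only: mult.commute[of "4 :: int"] flip: power_add distrib_right of_nat_add)
    qed
    have "top_term (g ^ m - h ^ m) (1 + 4 * int (m - 1)) (2 * (\<Sum>i<m. (?U * ?V) ^ (m - 1)))"
      unfolding eq by (rule top_term_mult[OF top2 sum])
    from top_term_mult[OF top_term_scal[of \<alpha>] this] show ?thesis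
      using \<open>m > 0\<close> by (simp add: \<delta>_def e_def of_nat_diff algebra_simps del: mult_pCons_left mult_pCons_right)
  qed
  have F: "F \<in> subalgebra fls_X_inv Z1" "F \<in> subalgebra fls_X Z3"
    unfolding F_def using f g
    by (auto intro!: subalgebra_diff subalgebra.mult subalgebra.scalar subalgebra_power)
  have "F + \<delta> = f - scal \<alpha> * h ^ m"
    by (simp add: F_def \<delta>_def algebra_simps)
  then have F12: "F + \<delta> \<in> subalgebra fls_X Z12"
    using f(3) g(3) unfolding h_def
    by (auto intro!: subalgebra_diff subalgebra.mult subalgebra.scalar subalgebra_power)
  have "top_term (scal \<alpha> * g ^ m) (4 * int m) a"
    using top_term_mult[OF top_term_scal[of \<alpha>] top_term_power[OF top_g, of m]]
    unfolding q \<alpha> power_mult_distrib by (simp only: mult_ac add_0)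
  then have F_top: "top_term F (4 * int m) 0"
    using top_term_diff[OF a(1)] unfolding F_def nm by fastforce
  \<comment> \<open>At weights \<open>4 m - 1\<close> and \<open>4 m - 2\<close> the defect \<open>\<delta>\<close> is not yet visible.\<close>
  have step: "top_term F (N - 1) 0"
    if "top_term F N 0" "4 * int m - 1 \<le> N" "N \<le> 4 * int m" for N
  proof -
    define b where "b = F $$ (1 - N)"
    have b: "top_term F (N - 1) b"
      unfolding b_def by (rule top_term_lower) fact
    then have "top_term (F + \<delta>) (N - 1) b"
      using top_term_add[OF b top_term_raise[OF top_\<delta>, of "N - 1"]] that by simp
    then have "?V ^ m dvd b" by (rule dvd12[OF F12]) (use that in simp)
    moreover have "?U ^ m dvd b" by (rule dvd3[OF F(2) b]) (use that in simp)
    \<comment> \<open>A nonzero \<open>b\<close> would have degree at least \<open>2 * m\<close>,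
      while chart 1 gives \<open>2 * degree b \<le> N - 1 < 4 * m\<close>.\<close>
    moreover have "2 * degree b < 2 * (m + m)"
      using degree1[OF F(1), of "nat (N - 1)" b] b that \<open>m > 0\<close> by simp
    ultimately have "b = 0"
      using two_degree[of m b m] by force
    then show ?thesis using b by simp
  qed
  define b where "b = F $$ (- (4 * int m - 3))"
  have b: "top_term F (4 * int m - 3) b"
    using top_term_lower[OF step[OF step[OF F_top]]] by (simp add: b_def)
  have b_U: "?U ^ m dvd b" by (rule dvd3[OF F(2) b]) simp
  have V: "?V ^ m dvd b + e" by (rule dvd12[OF F12 top_term_add[OF b top_\<delta>]]) simp
  \<comment> \<open>Chart 12 now controls only \<open>b + e\<close>, at the cost of one factor w + 2
    for \<open>b\<close>. This still suffices: a nonzero \<open>b\<close> would have degree at least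
    2 m - 1, but twice its degree is at most 4 m - 3.\<close>
  have "?V ^ (m - 1) dvd e"
    unfolding e_def power_mult_distrib by (intro dvd_mult dvd_refl)
  moreover have "?V ^ (m - 1) dvd b + e"
    using V by (rule power_le_dvd) simp
  ultimately have "?V ^ (m - 1) dvd b"
    by (simp add: dvd_add_left_iff)
  then have "b = 0"
    using two_degree[OF b_U, of "m - 1"] degree1[OF F(1), of "4 * m - 3" b] b \<open>m > 0\<close>
    by (force simp: of_nat_diff)
  \<comment> \<open>With \<open>b = 0\<close>, the power (w + 2)^m divides \<open>e\<close>, which
    visibly contains only m - 1 such factors. Cancelling them and evaluating at w = -2 gives
    \<alpha> = 0.\<close>
  then have "?V ^ (m - 1) * ?V dvd ?V ^ (m - 1) * ([:\<alpha>:] * (2 * (of_nat m * ?U ^ (m - 1))))"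
    using V \<open>m > 0\<close> unfolding e_def power_mult_distrib
    by (simp only: add_0 mult_ac flip: power_Suc) simp
  then have "?V dvd [:\<alpha>:] * (2 * (of_nat m * ?U ^ (m - 1)))"
    by (subst (asm) dvd_mult_cancel_left) simp
  then have "poly ([:\<alpha>:] * (2 * (of_nat m * ?U ^ (m - 1)))) (- 2) = 0"
    by (simp only: poly_eq_0_iff_dvd minus_minus)
  moreover have "poly (of_nat m) (- 2) = (of_nat m :: 'k)"
    by (simp add: of_nat_poly)
  ultimately show False
    using \<open>q \<noteq> 0\<close> \<open>m > 0\<close> by (simp add: \<alpha> poly_power)
qed

lemma scal_sum: "scal (sum f I) = (\<Sum>i\<in>I. scal (f i))"
  by (induction I rule: infinite_finite_induct) (simp_all add: scal_hom)

section \<open>Expansion of functions on the overlaps\<close>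

text \<open>The scalars are \<open>\<complex>[c][t]\<close>, with \<open>t\<close> the outer variable; \<open>Z\<close> is the image of \<open>z\<close>, while
  \<open>y = 1 / r\<close>.\<close>

definition laurent_hom :: "complex poly poly poly fls \<Rightarrow> overlap_ring \<Rightarrow> complex poly poly poly fls"
  where "laurent_hom Z F = (\<Sum>m\<in>Poly_Mapping.keys F. case m of (i, j, k, l) \<Rightarrow>
    scal (monom (monom (Poly_Mapping.lookup F m) l) k) * (fls_X_intpow i * Z ^ j))"

lemma laurent_hom_add: "laurent_hom Z (F + G) = laurent_hom Z F + laurent_hom Z G"
  unfolding laurent_hom_def
  by (rule sum_keys_add[where f = "\<lambda>m x. case m of (i, j, k, l) \<Rightarrow>
        scal (monom (monom x l) k) * (fls_X_intpow i * Z ^ j)"])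
    (auto simp: scal_hom distrib_right simp flip: add_monom)

lemma laurent_hom_single:
  "laurent_hom Z (Poly_Mapping.single (i, j, k, l) x) =
    scal (monom (monom x l) k) * (fls_X_intpow i * Z ^ j)"
  unfolding laurent_hom_def
  by (subst sum_keys_single[where f = "\<lambda>m x. case m of (i, j, k, l) \<Rightarrow>
        scal (monom (monom x l) k) * (fls_X_intpow i * Z ^ j)"])
    (auto simp: scal_hom)

lemma laurent_hom_zero: "laurent_hom Z 0 = 0"
  by (simp add: laurent_hom_def)

lemma laurent_hom_mult: "laurent_hom Z (F * G) = laurent_hom Z F * laurent_hom Z G"
proof -
  have *: "laurent_hom Z (Poly_Mapping.single n x * G) =
      laurent_hom Z (Poly_Mapping.single n x) * laurent_hom Z G" for n x
  proof (induction G rule: poly_mapping_single_induct)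
    case (add m y P)
    obtain i j k l where n: "n = (i, j, k, l)" by (cases n)
    obtain i' j' k' l' where m: "m = (i', j', k', l')" by (cases m)
    have "scal (monom (monom (x * y) (l + l')) (k + k')) =
        scal (monom (monom x l) k) * scal (monom (monom y l') k')"
      by (simp add: mult_monom flip: scal_hom)
    then have "laurent_hom Z (Poly_Mapping.single n x * Poly_Mapping.single m y) =
      laurent_hom Z (Poly_Mapping.single n x) * laurent_hom Z (Poly_Mapping.single m y)"
      unfolding n m mult_single add_Pair laurent_hom_single power_add
        fls_X_intpow_times_fls_X_intpow[of i i', symmetric]
      by (simp only: mult_ac)
    with add show ?case
      by (simp add: distrib_left laurent_hom_add)
  qed (simp add: laurent_hom_zero)
  show ?thesis
    by (induction F rule: poly_mapping_single_induct)
      (simp_all add: laurent_hom_zero laurent_hom_add distrib_right *)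
qed

lemma laurent_hom_gens:
  "laurent_hom Z vy = fls_X" "laurent_hom Z inv_vy = fls_X_inv" "laurent_hom Z vz = Z"
  "laurent_hom Z vt = scal [:0, 1:]" "laurent_hom Z vc = scal [:[:0, 1:]:]"
  "laurent_hom Z (cst x) = scal [:[:x:]:]"
  by (simp_all add: vy_def vz_def vt_def vc_def cst_def inv_vy_def laurent_hom_single monom_altdef
      scal_hom fls_X_conv_shift_1 fls_X_inv_conv_shift_1 flip: one_pCons)

lemma laurent_hom_one: "laurent_hom Z 1 = 1"
  using laurent_hom_gens(6)[of Z 1] by (simp add: cst_hom scal_hom flip: one_pCons)

lemma laurent_hom_numeral: "laurent_hom Z 2 = 2"
  unfolding one_add_one[symmetric] laurent_hom_add laurent_hom_one ..

lemma laurent_hom_uminus: "laurent_hom Z (- F) = - laurent_hom Z F"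
  using laurent_hom_add[of Z F "- F"]
  by (simp add: laurent_hom_zero eq_neg_iff_add_eq_0 add.commute)

lemma laurent_hom_diff: "laurent_hom Z (F - G) = laurent_hom Z F - laurent_hom Z G"
  using laurent_hom_add[of Z F "- G"] by (simp add: laurent_hom_uminus)

lemma laurent_hom_power: "laurent_hom Z (F ^ n) = laurent_hom Z F ^ n"
  by (induction n) (simp_all add: laurent_hom_one laurent_hom_mult)

lemmas laurent_hom_hom = laurent_hom_zero laurent_hom_one laurent_hom_numeral laurent_hom_add
  laurent_hom_mult laurent_hom_uminus laurent_hom_diff laurent_hom_power laurent_hom_gens

lemma laurent_hom_pull_fun_single:
  "laurent_hom Z (pull_fun (a, b) (Poly_Mapping.single (i, j, k, l) x)) =
    scal (monom (monom x l) k) * (laurent_hom Z a ^ i * laurent_hom Z b ^ j)"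
proof -
  have pow: "scal x ^ n = scal (x ^ n)" for x :: "complex poly poly" and n
    by (induction n) (simp_all add: scal_hom)
  have "scal (monom (monom x l) k) = scal ([:[:x:]:] * [:0, 1:] ^ k * [:[:0, 1:]:] ^ l)"
    by (simp add: monom_altdef poly_const_pow mult.commute)
  then show ?thesis
    unfolding pull_fun_single laurent_hom_hom pow scal_hom by (simp only: mult_ac)
qed

text \<open>This allows one chart function to be compared on two overlaps with different
  coordinates.\<close>

lemma laurent_hom_pull_fun_cong:
  assumes "laurent_hom Z a = laurent_hom Z' a'" "laurent_hom Z b = laurent_hom Z' b'"
  shows "laurent_hom Z (pull_fun (a, b) F) = laurent_hom Z' (pull_fun (a', b') F)"
proof (induction F rule: poly_mapping_single_induct)
  case (add n x P)
  then show ?case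
    by (cases n) (simp add: pull_fun_add laurent_hom_add laurent_hom_pull_fun_single assms)
qed (simp add: pull_fun_zero laurent_hom_zero)

lemma laurent_hom_pull_fun_mem:
  "laurent_hom Z (pull_fun (a, b) F) \<in> subalgebra (laurent_hom Z a) (laurent_hom Z b)"
proof (induction F rule: poly_mapping_single_induct)
  case zero
  show ?case
    using subalgebra.scalar[of 0] by (simp add: pull_fun_zero laurent_hom_zero scal_hom)
next
  case (add n x P)
  then show ?case
    by (cases n) (auto simp: pull_fun_add laurent_hom_add laurent_hom_pull_fun_single
        intro!: subalgebra.add subalgebra.mult subalgebra.scalar
          subalgebra_power[OF subalgebra.gen1] subalgebra_power[OF subalgebra.gen2])
qed

lemma laurent_hom_pull_fun_incl_mem: "laurent_hom Z (pull_fun incl F) \<in> subalgebra fls_X Z"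
  using laurent_hom_pull_fun_mem[of Z vy vz F] by (simp add: incl_def laurent_hom_gens)

text \<open>Distinct monomials of chart 1 occupy distinct places of the expansion, so no information
  is lost and the coefficients can be read off.\<close>

lemma lookup_laurent_hom_pull_fun:
  assumes "laurent_hom Z a = fls_X_inv" "laurent_hom Z b = fls_X_inv ^ 2 * W"
  shows "Poly_Mapping.lookup F (i, j, k, l) =
    coeff (coeff (coeff (laurent_hom Z (pull_fun (a, b) F) $$ (- int (i + 2 * j))) j) k) l"
proof (induction F rule: poly_mapping_single_induct)
  case (add n x P)
  obtain i' j' k' l' where n: "n = (i', j', k', l')" by (cases n)
  show ?case
    unfolding pull_fun_add laurent_hom_add n laurent_hom_pull_fun_single assms
      fls_X_inv_monomial lookup_add add.IH
    by (auto simp: fls_X_inv_power_times_conv_shift lookup_single when_def)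
qed (simp add: pull_fun_zero laurent_hom_zero)

text \<open>Gluing fixes the Hamiltonians on an overlap only up to functions of t and c. Their
  expansions are scalars and so lie in every subalgebra.\<close>

lemma laurent_hom_scalar:
  assumes "\<And>i j k l. i \<noteq> 0 \<or> j \<noteq> 0 \<Longrightarrow> Poly_Mapping.lookup G (i, j, k, l) = 0"
  shows "laurent_hom Z G \<in> range scal"
proof -
  have "laurent_hom Z G = (\<Sum>m\<in>Poly_Mapping.keys G. scal (case m of (i, j, k, l) \<Rightarrow>
      monom (monom (Poly_Mapping.lookup G m) l) k))"
    unfolding laurent_hom_def
  proof (rule sum.cong)
    fix m assume "m \<in> Poly_Mapping.keys G"
    moreover obtain i j k l where "m = (i, j, k, l)" by (cases m)
    moreover have "i = 0 \<and> j = 0"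
      using calculation assms[of i j k l] by (metis in_keys_iff)
    ultimately show "(case m of (i, j, k, l) \<Rightarrow>
        scal (monom (monom (Poly_Mapping.lookup G m) l) k) * (fls_X_intpow i * Z ^ j)) =
      scal (case m of (i, j, k, l) \<Rightarrow> monom (monom (Poly_Mapping.lookup G m) l) k)"
      by simp
  qed simp
  then show ?thesis by (simp flip: scal_sum)
qed

section \<open>Differences of Hamiltonians on the overlaps\<close>

text \<open>The hypothesis excludes collisions of shifted monomials. Truncated subtraction
  identifies the exponents 0 and 1, but the weight vanishes at 0.\<close>

lemma lookup_pderiv_along:
  assumes "\<And>n. w n \<noteq> 0 \<Longrightarrow> n - s = m - s \<Longrightarrow> n = m"
  shows "w m \<noteq> 0 \<Longrightarrow> Poly_Mapping.lookup (pderiv_along w s F) (m - s) = w m * Poly_Mapping.lookup F m"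
proof (induction F rule: poly_mapping_single_induct)
  case (add n x P)
  then show ?case
    using assms[of n]
    by (auto simp: pderiv_along_add pderiv_along_single lookup_add lookup_single when_def algebra_simps)
qed (simp add: pderiv_along_def)

text \<open>Wedging with dt retains the y- and z-derivatives. Both vanish, and in characteristic 0
  this kills every monomial involving y or z.\<close>

lemma d_overlap_wedge_vt_eq_0:
  assumes "d_overlap F \<and>\<^sub>f d_overlap vt = 0" and "i \<noteq> 0 \<or> j \<noteq> 0"
  shows "Poly_Mapping.lookup F (i, j, k, l) = 0"
proof -
  have y: "pderiv_along (\<lambda>(i, j, k, l). of_int i) (1, 0, 0, 0) F = 0"
    and z: "pderiv_along (\<lambda>(i, j, k, l). of_nat j) (0, 1, 0, 0) F = 0"
    using assms(1) unfolding d_overlap_gens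
    by (simp_all add: differential_def wedge_def zero_prod_def)
  show ?thesis
  proof (cases "i = 0")
    case False
    then show ?thesis
      using lookup_pderiv_along[of "\<lambda>(i, j, k, l). of_int i" "(1, 0, 0, 0)" "(i, j, k, l)" F]
      unfolding y by (auto split: prod.splits)
  next
    case True
    then show ?thesis
      using assms(2) lookup_pderiv_along[of "\<lambda>(i, j, k, l). of_nat j" "(0, 1, 0, 0)" "(i, j, k, l)" F]
      unfolding z by (auto split: prod.splits)
  qed
qed

lemma independent_of_yzI:
  assumes "\<And>i j k l. i \<noteq> 0 \<or> j \<noteq> 0 \<Longrightarrow> Poly_Mapping.lookup F (i, j, k, l) = 0"
  shows "independent_of_yz F"
  unfolding independent_of_yz_def
proof clarify
  fix i j k l
  assume "(i, j, k, l) \<in> Poly_Mapping.keys F"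
  then show "i = 0 \<and> j = 0"
    using assms[of i j k l] by (cases "i = 0 \<and> j = 0") (simp_all add: in_keys_iff)
qed

text \<open>All gluing maps are over the (t,c)-plane, so they fix functions of t and c.\<close>

lemma pull_fun_independent_of_yz:
  assumes "independent_of_yz F"
  shows "pull_fun \<tau> F = pull_fun \<tau>' F"
proof -
  obtain a b a' b' where \<tau>: "\<tau> = (a, b)" "\<tau>' = (a', b')" by (cases \<tau>; cases \<tau>')
  show ?thesis
    unfolding \<tau> pull_fun_def prod.case
  proof (rule sum.cong[OF refl])
    fix m assume m: "m \<in> Poly_Mapping.keys F"
    obtain k l where "m = (0, 0, k, l)"
      using assms m unfolding independent_of_yz_def by (cases m) auto
    then show "(case m of (i, j, k, l) \<Rightarrow>
        cst (Poly_Mapping.lookup F m) * a ^ i * b ^ j * vt ^ k * vc ^ l) =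
      (case m of (i, j, k, l) \<Rightarrow>
        cst (Poly_Mapping.lookup F m) * a' ^ i * b' ^ j * vt ^ k * vc ^ l)"
      by simp
  qed
qed

text \<open>On subtraction the pulled back forms dy wedge dz cancel, and only the differential of
  the discrepancy wedged with dt remains.\<close>

lemma hamiltonian_forms_agree_diff:
  assumes "pull_form \<tau> (hamiltonian_form H) = pull_form \<tau>' (hamiltonian_form G)"
    and "pull_form \<tau> (hamiltonian_form H') = pull_form \<tau>' (hamiltonian_form G')"
    and "i \<noteq> 0 \<or> j \<noteq> 0"
  shows "Poly_Mapping.lookup (pull_fun \<tau> (H - H') - pull_fun \<tau>' (G - G')) (i, j, k, l) = 0"
proof (rule d_overlap_wedge_vt_eq_0[OF _ assms(3)])
  obtain a b a' b' where \<tau>: "\<tau> = (a, b)" "\<tau>' = (a', b')" by (cases \<tau>; cases \<tau>')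
  have minus_wedge: "(x - y) \<and>\<^sub>f v = (x \<and>\<^sub>f v) - (y \<and>\<^sub>f v)" for x y v :: "overlap_ring form1"
    by (cases x; cases y; cases v) (simp add: wedge_def algebra_simps)
  note eq = assms(1,2)[unfolded \<tau> pull_hamiltonian_form]
  show "d_overlap (pull_fun \<tau> (H - H') - pull_fun \<tau>' (G - G')) \<and>\<^sub>f d_overlap vt = 0"
    unfolding \<tau> pull_fun_diff d_overlap_diff minus_wedge
    using arg_cong2[OF eq, of "(-)"] by (simp add: algebra_simps)
qed

section \<open>The charts of the Okamoto family\<close>

text \<open>\<open>z\<^sub>3\<close> and \<open>z\<^sub>1\<^sub>2\<close>, obtained by solving \<open>y\<^sub>1 = r\<close>, \<open>z\<^sub>1 = r\<^sup>2 w\<close> in the gluing rules.\<close>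

definition laurent3 :: "complex poly poly poly fls"
  where "laurent3 = scal [:[:0, 1:]:] * fls_X_inv - fls_X_inv ^ 4 * W"

definition laurent12 :: "complex poly poly poly fls"
  where "laurent12 = - (fls_X_inv ^ 4 * (W + 2)) - scal [:0, 1:] * fls_X_inv ^ 2
    - (scal [:[:0, 1:]:] + 1) * fls_X_inv"

lemma top_term_X_inv_power: "top_term (fls_X_inv ^ n) (int n) 1"
  using top_term_power[OF top_term_X_inv, of n] by simp

lemma fls_X_X_inv: "fls_X * fls_X_inv = (1 :: 'a::comm_ring_1 fls)"
  by (simp add: fls_X_times_conv_shift fls_X_inv_conv_shift_1)

lemma top_term_laurent3: "top_term laurent3 4 [:0, - 1:]"
proof -
  have "top_term (scal [:[:0, 1:]:] * fls_X_inv :: complex poly poly poly fls) 4 0"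
    using top_term_raise[OF top_term_mult[OF top_term_scal top_term_X_inv], of 4] by simp
  moreover have "top_term (fls_X_inv ^ 4 * W :: complex poly poly poly fls) 4 [:0, 1:]"
    using top_term_mult[OF top_term_X_inv_power[of 4] top_term_const[of "[:0, 1:]"]] by simp
  ultimately show ?thesis
    unfolding laurent3_def using top_term_diff by fastforce
qed

lemma W_add_2: "W + 2 = (fls_const [:2, 1:] :: 'k::idom poly fls)"
proof -
  have "[:2, 1:] = [:0, 1:] + (2 :: 'k poly)" by (simp add: numeral_poly)
  then show ?thesis unfolding fls_const_numeral[symmetric] fls_plus_const by simp
qed

lemma top_term_laurent12: "top_term laurent12 4 [:- 2, - 1:]"
proof -
  have t: "top_term (scal [:0, 1:] * fls_X_inv ^ 2 :: complex poly poly poly fls) 4 0"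
    using top_term_raise[OF top_term_mult[OF top_term_scal top_term_X_inv_power[of 2]], of 4] by simp
  have c: "top_term ((scal [:[:0, 1:]:] + 1) * fls_X_inv :: complex poly poly poly fls) 4 0"
    using top_term_raise[OF top_term_mult[OF top_term_add[OF top_term_scal top_term_scal[of 1]] top_term_X_inv], of 4]
    by (simp add: scal_hom)
  have w: "top_term (- (fls_X_inv ^ 4 * (W + 2)) :: complex poly poly poly fls) 4 [:- 2, - 1:]"
    using top_term_mult[OF top_term_X_inv_power[of 4] top_term_const[of "[:2, 1:]"]]
    unfolding W_add_2 by (simp add: top_term_def)
  show ?thesis
    using top_term_diff[OF top_term_diff[OF w t] c] by (simp add: laurent12_def)
qed

lemma laurent_hom_trans_3_1:
  "laurent_hom laurent3 (fst trans_3_1) = fls_X_inv"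
  "laurent_hom laurent3 (snd trans_3_1) = fls_X_inv ^ 2 * W"
proof -
  have "x * (c - x * (c * r - r ^ 4 * w)) = r ^ 2 * w" if "x * r = 1"
    for x r c w :: "complex poly poly poly fls"
    using that by algebra
  from this[OF fls_X_X_inv] show "laurent_hom laurent3 (snd trans_3_1) = fls_X_inv ^ 2 * W"
    unfolding trans_3_1_def laurent3_def snd_conv laurent_hom_hom .
qed (simp add: trans_3_1_def laurent_hom_hom)

lemma laurent_hom_trans_12_1:
  "laurent_hom laurent12 (fst trans_12_1) = fls_X_inv"
  "laurent_hom laurent12 (snd trans_12_1) = fls_X_inv ^ 2 * W"
proof -
  have "x * (- (c + 1) - x * (- (r ^ 4 * (w + 2)) - t * r ^ 2 - (c + 1) * r)) - 2 * r ^ 2 - t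
      = r ^ 2 * w" if "x * r = 1"
    for x r c t w :: "complex poly poly poly fls"
    using that by algebra
  from this[OF fls_X_X_inv] show "laurent_hom laurent12 (snd trans_12_1) = fls_X_inv ^ 2 * W"
    unfolding trans_12_1_def laurent12_def snd_conv laurent_hom_hom .
qed (simp add: trans_12_1_def laurent_hom_hom)

text \<open>Both expansions send y_1 to r and z_1 to r^2 w, so a function on chart 1 has one
  expansion, whichever overlap it is restricted to.\<close>

lemma laurent_hom_trans_eq:
  "laurent_hom laurent3 (pull_fun trans_3_1 F) = laurent_hom laurent12 (pull_fun trans_12_1 F)"
  using laurent_hom_pull_fun_cong[of laurent3 "fst trans_3_1" laurent12 "fst trans_12_1"
      "snd trans_3_1" "snd trans_12_1" F]
  by (simp add: laurent_hom_trans_3_1 laurent_hom_trans_12_1)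

lemma laurent_hom_H1:
  "2 * laurent_hom laurent3 (pull_fun trans_3_1 H1) =
    fls_X_inv ^ 4 * (W * (W + 2)) + scal [:0, 1:] * (fls_X_inv ^ 2 * W)
    - 2 * (scal [:[:0, 1:]:] * fls_X_inv)"
proof -
  have *: "2 * (r ^ 2 * z + h * z ^ 2 + h * t * z - c * r) =
      r ^ 4 * (w * (w + 2)) + t * (r ^ 2 * w) - 2 * (c * r)"
    if "2 * h = 1" "z = r ^ 2 * w"
    for r z c t w h :: "complex poly poly poly fls"
    using that by algebra
  have half: "2 * scal [:[:1 / 2:]:] = (1 :: complex poly poly poly fls)"
    unfolding mult_2 by (simp flip: scal_hom one_pCons)
  obtain a b where t: "trans_3_1 = (a, b)" by (cases trans_3_1)
  note ab = laurent_hom_trans_3_1[unfolded t fst_conv snd_conv]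
  show ?thesis
    unfolding t H1_def pull_fun_hom laurent_hom_hom ab by (rule *[OF half refl])
qed

lemma top_term_laurent_hom_H1:
  "top_term (2 * laurent_hom laurent3 (pull_fun trans_3_1 H1)) 4 ([:0, 1:] * [:2, 1:])"
proof -
  let ?c = "fls_const :: _ \<Rightarrow> complex poly poly poly fls"
  have WW: "W * (W + 2) = ?c ([:0, 1:] * [:2, 1:])"
    unfolding W_add_2 fls_const_mult_const ..
  have t: "top_term (scal [:0, 1:] * (fls_X_inv ^ 2 * W) :: complex poly poly poly fls) 4 0"
    using top_term_raise[OF top_term_mult[OF top_term_scal top_term_mult[OF top_term_X_inv_power[of 2] top_term_const]], of 4]
    by simp
  have c: "top_term (?c 2 * (scal [:[:0, 1:]:] * fls_X_inv)) 4 0"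
    using top_term_raise[OF top_term_mult[OF top_term_const[of 2] top_term_mult[OF top_term_scal top_term_X_inv]], of 4]
    by simp
  have w: "top_term (fls_X_inv ^ 4 * ?c ([:0, 1:] * [:2, 1:])) 4 ([:0, 1:] * [:2, 1:])"
    using top_term_mult[OF top_term_X_inv_power[of 4] top_term_const] by (simp only: mult_1 of_nat_numeral add_0_right)
  show ?thesis
    using top_term_diff[OF top_term_add[OF w t] c]
    unfolding laurent_hom_H1 WW fls_const_numeral by (simp only: add_0_right diff_zero)
qed

section \<open>Uniqueness of the Hamiltonians\<close>

theorem mainTheorem2:
  fixes H1' H3' H12' :: chart_ring
  assumes "glue_together (hamiltonian_form H1') (hamiltonian_form H3') (hamiltonian_form H12')"
  shows "independent_of_yz (H1 - H1') \<and> independent_of_yz (H3 - H3') \<and>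
    independent_of_yz (H12 - H12')"
proof -
  \<comment> \<open>These are the discrepancies on the overlaps with chart 1. By the gluing
    conditions they depend on t and c only.\<close>
  define e3 where "e3 = pull_fun trans_3_1 (H1 - H1') - pull_fun incl (H3 - H3')"
  define e12 where "e12 = pull_fun trans_12_1 (H1 - H1') - pull_fun incl (H12 - H12')"
  have e: "Poly_Mapping.lookup e3 (i, j, k, l) = 0" "Poly_Mapping.lookup e12 (i, j, k, l) = 0"
    if "i \<noteq> 0 \<or> j \<noteq> 0" for i j k l
    unfolding e3_def e12_def
    by (rule hamiltonian_forms_agree_diff[OF _ _ that];
        use assms hamiltonian_forms_glue in \<open>simp add: glue_together_def\<close>)+
  define f where "f = laurent_hom laurent3 (pull_fun trans_3_1 (H1 - H1'))"
  define g where "g = 2 * laurent_hom laurent3 (pull_fun trans_3_1 H1)"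
  have mem1: "laurent_hom laurent3 (pull_fun trans_3_1 F) \<in> subalgebra fls_X_inv (fls_X_inv ^ 2 * W)" for F
    using laurent_hom_pull_fun_mem[of laurent3 "fst trans_3_1" "snd trans_3_1" F]
    by (simp add: laurent_hom_trans_3_1)
  have scalar_add: "h + s \<in> subalgebra Y Z" if "s \<in> range scal" "h \<in> subalgebra Y Z"
    for s h Y Z :: "complex poly poly poly fls"
    using that by (auto intro: subalgebra.add subalgebra.scalar)
  have f: "f \<in> subalgebra fls_X laurent3" "f \<in> subalgebra fls_X laurent12"
  proof -
    have "f = laurent_hom laurent3 (pull_fun incl (H3 - H3')) + laurent_hom laurent3 e3"
      by (simp add: f_def e3_def flip: laurent_hom_add)
    then show "f \<in> subalgebra fls_X laurent3"
      using scalar_add[OF laurent_hom_scalar[OF e(1)] laurent_hom_pull_fun_incl_mem] by simp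
    have "f = laurent_hom laurent12 (pull_fun incl (H12 - H12')) + laurent_hom laurent12 e12"
      by (simp add: f_def e12_def laurent_hom_trans_eq flip: laurent_hom_add)
    then show "f \<in> subalgebra fls_X laurent12"
      using scalar_add[OF laurent_hom_scalar[OF e(2)] laurent_hom_pull_fun_incl_mem] by simp
  qed
  have double: "2 * h \<in> subalgebra Y Z" if "h \<in> subalgebra Y Z" for h Y Z :: "complex poly poly poly fls"
    unfolding mult_2 by (rule subalgebra.add[OF that that])
  have g: "g \<in> subalgebra fls_X_inv (fls_X_inv ^ 2 * W)" "g \<in> subalgebra fls_X laurent3"
    "g - 2 * fls_X_inv \<in> subalgebra fls_X laurent12"
  proof -
    show "g \<in> subalgebra fls_X_inv (fls_X_inv ^ 2 * W)"
      unfolding g_def by (rule double[OF mem1])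
    show "g \<in> subalgebra fls_X laurent3"
      unfolding g_def H3_substitution[symmetric] by (rule double[OF laurent_hom_pull_fun_incl_mem])
    \<comment> \<open>The defect 2 r is twice the correction 1/y_12 in the definition of H_12, since
      1/y_12 = r.\<close>
    have "g - 2 * fls_X_inv = 2 * laurent_hom laurent12 (pull_fun incl H12)"
      unfolding g_def laurent_hom_trans_eq H12_substitution pull_fun_trans_12_1_H1 laurent_hom_hom
      by (simp only: right_diff_distrib)
    then show "g - 2 * fls_X_inv \<in> subalgebra fls_X laurent12"
      using double[OF laurent_hom_pull_fun_incl_mem] by simp
  qed
  have "f \<in> range scal"
    by (rule subalgebra_inter_scalar[OF top_term_laurent3 top_term_laurent12
          mem1[of "H1 - H1'", folded f_def] f g top_term_laurent_hom_H1[folded g_def]])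
  \<comment> \<open>A scalar has only the coefficient of weight 0 and w-exponent 0, which is the
    place of i = j = 0.\<close>
  then have D1: "Poly_Mapping.lookup (H1 - H1') (i, j, k, l) = 0" if "i \<noteq> 0 \<or> j \<noteq> 0" for i j k l
    using that lookup_laurent_hom_pull_fun[of laurent3 "fst trans_3_1" "snd trans_3_1" "H1 - H1'" i j k l]
    by (auto simp: laurent_hom_trans_3_1 scal_def simp flip: f_def)
  have pull_D1: "pull_fun \<tau> (H1 - H1') = pull_fun incl (H1 - H1')" for \<tau>
    by (rule pull_fun_independent_of_yz[OF independent_of_yzI[OF D1]])
  \<comment> \<open>On each overlap the other difference equals the one of chart 1 minus the
    discrepancy, and both of these are free of y and z.\<close>
  have D: "Poly_Mapping.lookup (H3 - H3') (i, j, k, l) = 0" "Poly_Mapping.lookup (H12 - H12') (i, j, k, l) = 0"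
    if "i \<noteq> 0 \<or> j \<noteq> 0" for i j k l
    using e[of "int i" j k l] D1[of i j k l] that unfolding e3_def e12_def pull_D1[of trans_3_1] pull_D1[of trans_12_1]
    by (auto simp: lookup_minus lookup_pull_fun_incl)
  show ?thesis using independent_of_yzI D1 D by simp
qed

end
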